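(* Every essentially 5-edge-connected simple $(2,1)$-circuit $G$ that is not isomorphic to $K_5$ and has minimum degree $\delta(G)=4$ contains an admissible vertex (of degree four).
   Context: All graphs are finite. For a graph $G=(V,E)$ and $X\subseteq V$, $i_G(X)$ is the number of edges induced by $X$. A simple graph $G=(V,E)$ is a (simple) $(2,1)$-circuit if $|E|=2|V|$ and $i_G(X)\le 2|X|-1$ for all nonempty $X\subsetneq V$. A $k$-edge-cutset is a set of $k$ edges whose removal disconnects the graph; it is trivial if one of the resulting components consists of a single vertex, and non-trivial otherwise. A graph is essentially $k$-edge-connected if it has no non-trivial $(k-1)$-edge-cutset. An inverse $X$-replacement at a degree four vertex $v$ deletes $v$ and adds two edges with no common end vertex between the four neighbours of $v$ (so if $N(v)=\{x,y,z,w\}$ the added edges are, for some labelling of the neighbours, $xy$ and $zw$). A degree four vertex $v$ of $G$ is admissible if there is an inverse $X$-replacement removing $v$ that results in a $(2,1)$-circuit and in which the two added edges are between pairs of previously non-adjacent vertices (so the resulting circuit is again simple). *)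

theory Defs
  imports "HOL-Library.Ramsey"
begin

text \<open>
  A graph is given by its vertex set \<open>V\<close> and its set \<open>E\<close> of edges, an edge being the two-element set
  of its end vertices.  Graphs are nonempty, so that the minimum degree below is a minimum over a
  nonempty finite set.
\<close>

definition simple_graph :: "'a set \<Rightarrow> 'a set set \<Rightarrow> bool" where
  "simple_graph V E \<longleftrightarrow> finite V \<and> V \<noteq> {} \<and> E \<subseteq> [V]\<^bsup>2\<^esup>"

definition induced_edges :: "'a set set \<Rightarrow> 'a set \<Rightarrow> nat" where
  "induced_edges E X = card {e \<in> E. e \<subseteq> X}"

definition circuit_2_1 :: "'a set \<Rightarrow> 'a set set \<Rightarrow> bool" where
  "circuit_2_1 V E \<longleftrightarrow> simple_graph V E \<and> card E = 2 * card V \<and>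
     (\<forall>X. X \<noteq> {} \<and> X \<subset> V \<longrightarrow> induced_edges E X \<le> 2 * card X - 1)"

definition neighbours :: "'a set set \<Rightarrow> 'a \<Rightarrow> 'a set" where
  "neighbours E v = {u. {v, u} \<in> E}"

definition degree :: "'a set set \<Rightarrow> 'a \<Rightarrow> nat" where
  "degree E v = card {e \<in> E. v \<in> e}"

definition min_degree :: "'a set \<Rightarrow> 'a set set \<Rightarrow> nat" where
  "min_degree V E = Min (degree E ` V)"

definition isomorphic_graphs :: "'a set \<Rightarrow> 'a set set \<Rightarrow> 'b set \<Rightarrow> 'b set set \<Rightarrow> bool" where
  "isomorphic_graphs V E V' E' \<longleftrightarrow>
     (\<exists>f. bij_betw f V V' \<and> (\<forall>u\<in>V. \<forall>w\<in>V. {u, w} \<in> E \<longleftrightarrow> {f u, f w} \<in> E'))"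

text \<open>Edges of the complete graph on the vertex set \<open>{..<n}\<close>.\<close>

definition complete_edges :: "nat \<Rightarrow> nat set set" where
  "complete_edges n = [{..<n}]\<^bsup>2\<^esup>"

definition reachable :: "'a set set \<Rightarrow> 'a \<Rightarrow> 'a \<Rightarrow> bool" where
  "reachable E u w \<longleftrightarrow> (u, w) \<in> {(x, y). {x, y} \<in> E}\<^sup>*"

definition components :: "'a set \<Rightarrow> 'a set set \<Rightarrow> 'a set set" where
  "components V E = (\<lambda>v. {w \<in> V. reachable E v w}) ` V"

definition connected_graph :: "'a set \<Rightarrow> 'a set set \<Rightarrow> bool" where
  "connected_graph V E \<longleftrightarrow> (\<forall>u\<in>V. \<forall>w\<in>V. reachable E u w)"

text \<open>No minimality is required of a cutset: \<open>F\<close> may contain a smaller set whose removal already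
  disconnects the graph.\<close>

definition edge_cutset :: "nat \<Rightarrow> 'a set \<Rightarrow> 'a set set \<Rightarrow> 'a set set \<Rightarrow> bool" where
  "edge_cutset k V E F \<longleftrightarrow> F \<subseteq> E \<and> finite F \<and> card F = k \<and> \<not> connected_graph V (E - F)"

definition trivial_cutset :: "'a set \<Rightarrow> 'a set set \<Rightarrow> 'a set set \<Rightarrow> bool" where
  "trivial_cutset V E F \<longleftrightarrow> (\<exists>C \<in> components V (E - F). card C = 1)"

definition essentially_edge_connected :: "nat \<Rightarrow> 'a set \<Rightarrow> 'a set set \<Rightarrow> bool" where
  "essentially_edge_connected k V E \<longleftrightarrow>
     \<not> (\<exists>F. edge_cutset (k - 1) V E F \<and> \<not> trivial_cutset V E F)"

text \<open>
  The edge set left by the inverse X-replacement at \<open>v\<close> that adds \<open>xy\<close> and \<open>zw\<close>; its vertex set is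
  \<open>V - {v}\<close>.  An edge set cannot record a parallel edge, so this is the intended graph only when
  \<open>xy\<close> and \<open>zw\<close> are not already edges, which \<open>admissible\<close> requires.
\<close>

definition inverse_X_edges :: "'a set set \<Rightarrow> 'a \<Rightarrow> 'a \<Rightarrow> 'a \<Rightarrow> 'a \<Rightarrow> 'a \<Rightarrow> 'a set set" where
  "inverse_X_edges E v x y z w = {e \<in> E. v \<notin> e} \<union> {{x, y}, {z, w}}"

definition admissible :: "'a set \<Rightarrow> 'a set set \<Rightarrow> 'a \<Rightarrow> bool" where
  "admissible V E v \<longleftrightarrow> v \<in> V \<and> degree E v = 4 \<and>
     (\<exists>x y z w. distinct [x, y, z, w] \<and> neighbours E v = {x, y, z, w} \<and>
        {x, y} \<notin> E \<and> {z, w} \<notin> E \<and>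
        circuit_2_1 (V - {v}) (inverse_X_edges E v x y z w))"

end

theory Submission
  imports Defs
begin

text \<open>
  A \<open>(2,1)\<close>-circuit has average degree 4, so minimum degree 4 makes it 4-regular.  In a 4-regular
  graph \<open>2 * i(X) + d(X) = 4 * |X|\<close>, where \<open>d(X)\<close> counts the edges between \<open>X\<close> and its complement
  (\<open>card_boundary_regular\<close>).  Every sparsity condition thereby becomes a condition on edge cuts, and
  the circuit condition says just that the graph is connected.

  An inverse X-replacement keeps all degrees equal to 4, and can only disconnect the graph if the two
  new edges lie on the two sides of a 2-edge cut.  Enlarging such a cut by two suitable edges gives
  a non-trivial 4-edge-cutset, which is excluded.  Hence \<open>v\<close> is admissible as soon as its
  neighbours split into two non-adjacent pairs (\<open>admissibleI\<close>).

  If no such split exists, the graph induced on \<open>N(v)\<close> has an edge in each of the three perfect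
  matchings of the four neighbours, and three such edges form a triangle or a claw.  A triangle
  together with \<open>v\<close> is a complete graph on four vertices; only four edges leave it, and this
  forces \<open>G\<close> to be \<open>K\<^sub>5\<close> (\<open>no_complete_four\<close>).  So there is a claw, and its centre \<open>c\<close> is a twin of
  \<open>v\<close>: the two have the same closed neighbourhood (\<open>not_admissible_twin\<close>).  Suppose that
  every vertex is non-admissible, and let \<open>y\<close> be one of the three neighbours of \<open>v\<close> other than \<open>c\<close>.
  These three are pairwise non-adjacent, since an edge between two of them would form a triangle with
  \<open>c\<close>.  But \<open>y\<close> has a twin too, which is adjacent to \<open>v\<close> or equal to it, and
  wherever that twin lies, \<open>y\<close> becomes adjacent to another of the three.
\<close>

section \<open>Regularity and edge boundaries\<close>

definition boundary :: "'a set set \<Rightarrow> 'a set \<Rightarrow> 'a set set" where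
  "boundary E X = {e \<in> E. e \<inter> X \<noteq> {} \<and> \<not> e \<subseteq> X}"

lemma simple_graph_finite_edges:
  assumes "simple_graph V E"
  shows "finite E"
proof -
  have "finite ([V]\<^bsup>2\<^esup>)"
    using assms by (simp add: simple_graph_def finite_imp_finite_nsets)
  then show ?thesis
    using assms by (auto simp: simple_graph_def intro: finite_subset)
qed

lemma simple_graph_edgeE:
  assumes "simple_graph V E" "e \<in> E" "v \<in> e"
  obtains w where "e = {v, w}" "v \<noteq> w" "v \<in> V" "w \<in> V"
proof -
  have "e \<subseteq> V" "card e = 2"
    using assms by (auto simp: simple_graph_def nsets_def)
  then show ?thesis
    using assms(3) that by (auto simp: card_2_iff)
qed

lemma simple_graph_edge_ends:
  assumes "simple_graph V E" "{v, w} \<in> E"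
  shows "v \<noteq> w" "v \<in> V" "w \<in> V"
  using assms by (auto simp: simple_graph_def nsets_def)

text \<open>
  Double counting of incidences: an edge has two, one or no ends in \<open>X\<close> according to whether it lies
  inside \<open>X\<close>, in the boundary of \<open>X\<close>, or outside.
\<close>
lemma sum_degree_eq:
  assumes G: "simple_graph V E" and X: "X \<subseteq> V"
  shows "(\<Sum>u\<in>X. degree E u) = 2 * induced_edges E X + card (boundary E X)"
proof -
  have finE: "finite E" using G by (rule simple_graph_finite_edges)
  have finX: "finite X" using G X by (auto simp: simple_graph_def intro: finite_subset)
  have *: "card (e \<inter> X) = (if e \<subseteq> X then 2 else 0) + (if e \<inter> X \<noteq> {} \<and> \<not> e \<subseteq> X then 1 else 0)"
    if "e \<in> E" for e
  proof -
    have "card e = 2" using G that by (auto simp: simple_graph_def nsets_def)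
    then obtain a b where "e = {a, b}" "a \<noteq> b" by (auto simp: card_2_iff)
    then show ?thesis by (cases "a \<in> X"; cases "b \<in> X") (auto simp: Int_insert_left)
  qed
  have "(\<Sum>u\<in>X. degree E u) = (\<Sum>u\<in>X. \<Sum>e\<in>E. if u \<in> e then 1 else 0)"
    using finE by (simp add: degree_def sum.If_cases Int_def)
  also have "\<dots> = (\<Sum>e\<in>E. \<Sum>u\<in>X. if u \<in> e then 1 else 0)"
    by (rule sum.swap)
  also have "\<dots> = (\<Sum>e\<in>E. card (e \<inter> X))"
    using finX by (simp add: sum.If_cases Int_def conj_commute)
  also have "\<dots> = (\<Sum>e\<in>E. (if e \<subseteq> X then 2 else 0) + (if e \<inter> X \<noteq> {} \<and> \<not> e \<subseteq> X then 1 else 0))"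
    by (rule sum.cong[OF refl *])
  also have "\<dots> = 2 * induced_edges E X + card (boundary E X)"
    using finE by (simp add: sum.distrib sum.If_cases Int_def induced_edges_def boundary_def)
  finally show ?thesis .
qed

text \<open>
  The degrees sum to \<open>2 * card E = 4 * card V\<close>, which leaves no room for a degree above the
  minimum.
\<close>
lemma circuit_min_degree_4_regular:
  assumes C: "circuit_2_1 V E" and min: "min_degree V E = 4" and u: "u \<in> V"
  shows "degree E u = 4"
proof (rule ccontr)
  assume ne: "degree E u \<noteq> 4"
  have G: "simple_graph V E" and cE: "card E = 2 * card V"
    using C by (auto simp: circuit_2_1_def)
  have fin: "finite V" using G by (simp add: simple_graph_def)
  have ge: "4 \<le> degree E w" if "w \<in> V" for w
    using min fin that by (metis Min_le finite_imageI imageI min_degree_def)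
  have "{e \<in> E. e \<subseteq> V} = E" "boundary E V = {}"
    using G by (auto simp: simple_graph_def nsets_def boundary_def)
  then have "(\<Sum>w\<in>V. degree E w) = 4 * card V"
    using sum_degree_eq[OF G subset_refl] cE by (simp add: induced_edges_def)
  moreover have "(\<Sum>w\<in>V. 4) < (\<Sum>w\<in>V. degree E w)"
    using fin ge ne u by (intro sum_strict_mono_ex1) (auto intro!: bexI[of _ u] simp: less_le)
  ultimately show False by simp
qed

lemma card_boundary_regular:
  assumes G: "simple_graph V E" and reg: "\<And>u. u \<in> V \<Longrightarrow> degree E u = 4" and X: "X \<subseteq> V"
  shows "2 * induced_edges E X + card (boundary E X) = 4 * card X"
proof -
  have "(\<Sum>u\<in>X. degree E u) = (\<Sum>u\<in>X. 4)"
    using reg X by (intro sum.cong) auto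
  then show ?thesis using sum_degree_eq[OF G X] by simp
qed

lemma card_neighbours:
  assumes G: "simple_graph V E"
  shows "card (neighbours E v) = degree E v"
proof -
  have "bij_betw (\<lambda>u. {v, u}) (neighbours E v) {e \<in> E. v \<in> e}"
  proof (rule bij_betw_imageI)
    show "inj_on (\<lambda>u. {v, u}) (neighbours E v)" by (auto simp: inj_on_def doubleton_eq_iff)
    show "(\<lambda>u. {v, u}) ` neighbours E v = {e \<in> E. v \<in> e}"
    proof (intro equalityI subsetI)
      fix e assume "e \<in> {e \<in> E. v \<in> e}"
      then have e: "e \<in> E" "v \<in> e" by auto
      obtain w where "e = {v, w}" using simple_graph_edgeE[OF G e] by metis
      then show "e \<in> (\<lambda>u. {v, u}) ` neighbours E v" using e by (auto simp: neighbours_def)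
    qed (auto simp: neighbours_def)
  qed
  then show ?thesis by (simp add: degree_def bij_betw_same_card)
qed

section \<open>Four-edge cutsets\<close>

text \<open>
  The form in which essential 5-edge-connectivity is used.  Removing \<open>F\<close> separates \<open>X\<close> from its
  complement, so \<open>F\<close> is a trivial cutset and isolates some vertex \<open>u\<close>; the four edges at \<open>u\<close> then exhaust \<open>F\<close>.  Requiring
  only that \<open>F\<close> contains the boundary covers cuts with fewer than four edges as well.
\<close>
lemma four_edge_cutset_is_star:
  assumes G: "simple_graph V E" and reg: "\<And>u. u \<in> V \<Longrightarrow> degree E u = 4"
    and ess: "essentially_edge_connected 5 V E"
    and X: "X \<noteq> {}" "X \<subset> V"
    and F: "F \<subseteq> E" "card F = 4" "boundary E X \<subseteq> F"
  obtains u where "u \<in> V" "F = {e \<in> E. u \<in> e}"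
proof -
  obtain a b where ab: "a \<in> X" "b \<in> V - X" using X by auto
  have finF: "finite F" using F(2) by (metis card.infinite zero_neq_numeral)
  have stay: "w \<in> X" if "(a, w) \<in> {(x, y). {x, y} \<in> E - F}\<^sup>*" for w
    using that
  proof induction
    case base
    show ?case by (rule ab(1))
  next
    case (step y z)
    then show ?case using F(3) by (auto simp: boundary_def)
  qed
  have "\<not> connected_graph V (E - F)"
    using ab X stay by (auto simp: connected_graph_def reachable_def)
  then have "edge_cutset 4 V E F"
    using F finF by (simp add: edge_cutset_def)
  then have "trivial_cutset V E F"
    using ess by (auto simp: essentially_edge_connected_def)
  then obtain u where u: "u \<in> V" and c: "card {w \<in> V. reachable (E - F) u w} = 1"
    by (auto simp: trivial_cutset_def components_def)
  have uu: "u \<in> {w \<in> V. reachable (E - F) u w}"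
    using u by (simp add: reachable_def)
  have "{e \<in> E. u \<in> e} \<subseteq> F"
  proof (safe, rule ccontr)
    fix e assume e: "e \<in> E" "u \<in> e" "e \<notin> F"
    obtain w where w: "e = {u, w}" "u \<noteq> w" "w \<in> V"
      using simple_graph_edgeE[OF G e(1,2)] by metis
    have "w \<in> {w \<in> V. reachable (E - F) u w}"
      using w e by (auto simp: reachable_def)
    then show False using c uu w(2) by (metis card_1_singletonE singletonD)
  qed
  moreover have "card {e \<in> E. u \<in> e} = card F"
    using reg[OF u] F(2) by (simp add: degree_def)
  ultimately have "F = {e \<in> E. u \<in> e}"
    using finF by (metis card_subset_eq)
  with u show ?thesis by (rule that)
qed

text \<open>
  If the bound fails, the boundary of \<open>Y\<close> has two edges, which must be \<open>vx\<close> and \<open>vy\<close>.  Their only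
  common end is \<open>v\<close>, so adding to them an edge \<open>e\<close> inside \<open>Y\<close> and any fourth edge gives a 4-edge-cutset
  that cannot be the set of edges at a single vertex.
\<close>
lemma induced_edges_le_of_two_neighbours:
  assumes C: "circuit_2_1 V E" and reg: "\<And>u. u \<in> V \<Longrightarrow> degree E u = 4"
    and ess: "essentially_edge_connected 5 V E"
    and Y: "Y \<subset> V" "v \<notin> Y" "x \<in> Y" "y \<in> Y" "x \<noteq> y" and vx: "{v, x} \<in> E" and vy: "{v, y} \<in> E"
  shows "induced_edges E Y \<le> 2 * card Y - 2"
proof (rule ccontr)
  assume "\<not> ?thesis"
  moreover have G: "simple_graph V E" and cE: "card E = 2 * card V"
    using C by (auto simp: circuit_2_1_def)
  moreover have "induced_edges E Y \<le> 2 * card Y - 1"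
    using C Y by (auto simp: circuit_2_1_def)
  moreover have finV: "finite V" using G by (simp add: simple_graph_def)
  moreover have "card {x, y} \<le> card Y"
    using Y finV by (intro card_mono) (auto intro: finite_subset)
  ultimately have i: "induced_edges E Y = 2 * card Y - 1" and cY: "2 \<le> card Y"
    using Y(5) by auto
  have finE: "finite E" using G by (rule simple_graph_finite_edges)
  have "card (boundary E Y) = 2"
    using card_boundary_regular[OF G reg, of Y] Y i cY by auto
  moreover have "{{v, x}, {v, y}} \<subseteq> boundary E Y"
    using Y vx vy by (auto simp: boundary_def)
  moreover have "card {{v, x}, {v, y}} = 2"
    using Y(5) by (auto simp: doubleton_eq_iff)
  ultimately have bd: "boundary E Y = {{v, x}, {v, y}}"
    by (metis card_subset_eq card.infinite zero_neq_numeral)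
  have "card {e \<in> E. e \<subseteq> Y} \<noteq> 0"
    using i cY by (simp add: induced_edges_def)
  then have "{e \<in> E. e \<subseteq> Y} \<noteq> {}" by (metis card.empty)
  then obtain e where e: "e \<in> E" "e \<subseteq> Y" by auto
  have "card Y < card V" using Y finV by (simp add: psubset_card_mono)
  then have "3 < card E" using cE cY by simp
  moreover have "card {{v, x}, {v, y}, e} \<le> 3"
    by (simp add: card_insert_if)
  ultimately have "\<not> E \<subseteq> {{v, x}, {v, y}, e}"
    using card_mono[of "{{v, x}, {v, y}, e}" E] by auto
  then obtain f where f: "f \<in> E" "f \<notin> {{v, x}, {v, y}, e}" by auto
  let ?F = "{{v, x}, {v, y}, e, f}"
  have "v \<notin> e" using Y(2) e(2) by blast
  then have "e \<noteq> {v, x}" "e \<noteq> {v, y}" by blast+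
  moreover have "{v, x} \<noteq> {v, y}" using Y(5) by (auto simp: doubleton_eq_iff)
  ultimately have "distinct [{v, x}, {v, y}, e, f]"
    using f(2) by (metis distinct_length_2_or_more distinct_singleton insert_iff)
  then have four: "card ?F = 4"
    using distinct_card[of "[{v, x}, {v, y}, e, f]"] by simp
  have FE: "?F \<subseteq> E" "boundary E Y \<subseteq> ?F" and Y0: "Y \<noteq> {}"
    using vx vy e f bd Y by auto
  obtain u where u: "u \<in> V" "?F = {e \<in> E. u \<in> e}"
    using four_edge_cutset_is_star[OF G reg ess Y0 Y(1) FE(1) four FE(2)] by metis
  have at_u: "u \<in> g" if "g \<in> ?F" for g
    using that unfolding u(2) by simp
  have "u \<in> {v, x}" "u \<in> {v, y}" "u \<in> e" by (intro at_u; simp)+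
  then show False using Y(5) \<open>v \<notin> e\<close> by auto
qed

section \<open>Complete subgraphs on four vertices\<close>

lemma complete_on_five_isomorphic:
  assumes G: "simple_graph V E" and V: "card V = 5" "[V]\<^bsup>2\<^esup> \<subseteq> E"
  shows "isomorphic_graphs V E {..<5} (complete_edges 5)"
proof -
  have "finite V" using G by (simp add: simple_graph_def)
  then obtain f where f: "bij_betw f V {..<5::nat}"
    using V(1) by (metis finite_same_card_bij card_lessThan finite_lessThan)
  have E: "E = [V]\<^bsup>2\<^esup>" using G V by (auto simp: simple_graph_def)
  have "{u, w} \<in> E \<longleftrightarrow> {f u, f w} \<in> complete_edges 5" if "u \<in> V" "w \<in> V" for u w
  proof -
    have "f u \<in> {..<5}" "f w \<in> {..<5}" using f that by (auto simp: bij_betw_def)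
    moreover have "f u = f w \<longleftrightarrow> u = w"
      using f that by (auto simp: bij_betw_def inj_on_def)
    ultimately show ?thesis
      using that by (auto simp: E complete_edges_def nsets_def card_insert_if)
  qed
  with f show ?thesis by (auto simp: isomorphic_graphs_def)
qed

text \<open>
  Each vertex of \<open>K\<close> has one edge leaving \<open>K\<close>.  These four edges form a cutset, so they
  all end in one vertex \<open>u\<close>, and \<open>K\<close> with \<open>u\<close> is a complete graph on five vertices.  Its ten edges
  violate the circuit bound \<open>2 * 5 - 1\<close> unless it is all of \<open>G\<close>.
\<close>
lemma no_complete_four:
  assumes C: "circuit_2_1 V E" and reg: "\<And>u. u \<in> V \<Longrightarrow> degree E u = 4"
    and ess: "essentially_edge_connected 5 V E"
    and K5: "\<not> isomorphic_graphs V E {..<5} (complete_edges 5)"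
    and K: "card K = 4"
  shows "\<not> [K]\<^bsup>2\<^esup> \<subseteq> E"
proof
  assume KE: "[K]\<^bsup>2\<^esup> \<subseteq> E"
  have G: "simple_graph V E" and i: "\<And>X. X \<noteq> {} \<Longrightarrow> X \<subset> V \<Longrightarrow> induced_edges E X \<le> 2 * card X - 1"
    using C by (auto simp: circuit_2_1_def)
  have finV: "finite V" using G by (simp add: simple_graph_def)
  have finK: "finite K" using K by (metis card.infinite zero_neq_numeral)
  have induced: "induced_edges E X = card X choose 2" if "[X]\<^bsup>2\<^esup> \<subseteq> E" for X
  proof -
    have "{e \<in> E. e \<subseteq> X} = [X]\<^bsup>2\<^esup>"
      using that G by (auto simp: simple_graph_def nsets_def)
    then show ?thesis by (simp add: induced_edges_def)
  qed
  have adj: "{a, b} \<in> E" if "a \<in> K" "b \<in> K" "a \<noteq> b" for a b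
    using KE that by (auto simp: nsets_def)
  have other: "\<exists>b\<in>K. b \<noteq> a" for a
  proof (rule ccontr)
    assume "\<not> ?thesis"
    then have "K \<subseteq> {a}" by blast
    then have "card K \<le> card {a}" by (intro card_mono) auto
    then show False using K by simp
  qed
  have KV: "K \<subseteq> V"
    using adj other simple_graph_edge_ends[OF G] by (metis subsetI)
  have "card (boundary E K) = 4"
    using card_boundary_regular[OF G reg KV] induced[OF KE] K by (simp add: choose_two)
  moreover have "K \<noteq> V"
  proof
    assume "K = V"
    then have "boundary E K = {}"
      using G by (auto simp: simple_graph_def nsets_def boundary_def)
    with \<open>card (boundary E K) = 4\<close> show False by simp
  qed
  moreover have "K \<noteq> {}" "boundary E K \<subseteq> E"
    using K by (auto simp: boundary_def)
  ultimately obtain u where u: "u \<in> V" "boundary E K = {e \<in> E. u \<in> e}"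
    using four_edge_cutset_is_star[OF G reg ess, of K "boundary E K"] KV
    by (metis order_refl psubsetI)
  have uK: "u \<notin> K"
  proof
    assume "u \<in> K"
    then obtain b where "b \<in> K" "b \<noteq> u" using other by metis
    then have "{u, b} \<in> boundary E K" using u adj[of u b] \<open>u \<in> K\<close> by auto
    then show False using \<open>u \<in> K\<close> \<open>b \<in> K\<close> by (auto simp: boundary_def)
  qed
  have "neighbours E u \<subseteq> K"
  proof
    fix w assume "w \<in> neighbours E u"
    then have "{u, w} \<in> boundary E K" using u by (auto simp: neighbours_def)
    then show "w \<in> K" using uK by (auto simp: boundary_def)
  qed
  then have N: "neighbours E u = K"
    using card_neighbours[OF G, of u] reg[OF u(1)] K finK by (intro card_subset_eq) auto
  have c: "[insert u K]\<^bsup>2\<^esup> \<subseteq> E"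
  proof
    fix e assume "e \<in> [insert u K]\<^bsup>2\<^esup>"
    then obtain a b where e: "e = {a, b}" "a \<noteq> b" "a \<in> insert u K" "b \<in> insert u K"
      by (auto simp: nsets_def card_2_iff)
    have uw: "{u, w} \<in> E" if "w \<in> K" for w using that N by (auto simp: neighbours_def)
    show "e \<in> E" using e adj uw by (auto simp: insert_commute)
  qed
  have five: "card (insert u K) = 5" using uK K finK by simp
  show False
  proof (cases "insert u K = V")
    case True
    then show False using complete_on_five_isomorphic[OF G] c five K5 by simp
  next
    case False
    then have "induced_edges E (insert u K) \<le> 2 * card (insert u K) - 1"
      using u KV by (intro i) auto
    then show False by (simp only: induced[OF c] five) (simp add: choose_two)
  qed
qed

section \<open>Inverse X-replacement\<close>

text \<open>
  The vertex count drops by 1 and the edge count by 4 - 2, so only the sparsity bound is at issue.  If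
  \<open>Y\<close> contains all four neighbours, putting \<open>v\<close> back adds four edges and two to the bound, so the bound
  for \<open>insert v Y\<close> has room for both new edges.  If \<open>Y\<close> contains just one of the two new
  edges, it contains two neighbours of \<open>v\<close>, and \<open>induced_edges_le_of_two_neighbours\<close> leaves room
  for one more edge.
\<close>
lemma admissibleI:
  assumes C: "circuit_2_1 V E" and reg: "\<And>u. u \<in> V \<Longrightarrow> degree E u = 4"
    and ess: "essentially_edge_connected 5 V E"
    and v: "v \<in> V" and d: "distinct [x, y, z, w]" and N: "neighbours E v = {x, y, z, w}"
    and xy: "{x, y} \<notin> E" and zw: "{z, w} \<notin> E"
  shows "admissible V E v"
proof -
  have G: "simple_graph V E" and cE: "card E = 2 * card V"
    and ci: "\<And>X. X \<noteq> {} \<Longrightarrow> X \<subset> V \<Longrightarrow> induced_edges E X \<le> 2 * card X - 1"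
    using C by (auto simp: circuit_2_1_def)
  have finV: "finite V" using G by (simp add: simple_graph_def)
  have finE: "finite E" using G by (rule simple_graph_finite_edges)
  have vE: "{v, x} \<in> E" "{v, y} \<in> E" "{v, z} \<in> E" "{v, w} \<in> E"
    using N by (auto simp: neighbours_def)
  have nV: "x \<in> V - {v}" "y \<in> V - {v}" "z \<in> V - {v}" "w \<in> V - {v}"
    using vE simple_graph_edge_ends[OF G] by blast+
  let ?E = "inverse_X_edges E v x y z w"
  have simple: "simple_graph (V - {v}) ?E"
    using G nV d by (auto simp: simple_graph_def nsets_def inverse_X_edges_def)
  have "card ?E = card {e \<in> E. v \<notin> e} + card {{x, y}, {z, w}}"
    unfolding inverse_X_edges_def using finE xy zw by (intro card_Un_disjoint) auto
  moreover have "card {{x, y}, {z, w}} = 2"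
    using d by (auto simp: doubleton_eq_iff)
  moreover have "card E = card {e \<in> E. v \<notin> e} + card {e \<in> E. v \<in> e}"
    using finE by (subst card_Un_disjoint[symmetric]) (auto intro: arg_cong[where f = card])
  moreover have "card {e \<in> E. v \<in> e} = 4" using reg[OF v] by (simp add: degree_def)
  moreover have "card (V - {v}) = card V - 1" using v by simp
  ultimately have card: "card ?E = 2 * card (V - {v})" using cE by simp
  have "induced_edges ?E Y \<le> 2 * card Y - 1" if Y: "Y \<noteq> {}" "Y \<subset> V - {v}" for Y
  proof -
    have finY: "finite Y" using Y finV by (auto intro: finite_subset)
    have YV: "Y \<subset> V" "v \<notin> Y" using Y by auto
    have eq: "{e \<in> ?E. e \<subseteq> Y} = {e \<in> E. e \<subseteq> Y} \<union> {e \<in> {{x, y}, {z, w}}. e \<subseteq> Y}"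
      using YV by (auto simp: inverse_X_edges_def)
    have le: "induced_edges ?E Y \<le> induced_edges E Y + card {e \<in> {{x, y}, {z, w}}. e \<subseteq> Y}"
      unfolding induced_edges_def eq by (rule card_Un_le)
    have pos: "0 < card Y" using Y finY by (simp add: card_gt_0_iff)
    consider (none) "\<not> {x, y} \<subseteq> Y" "\<not> {z, w} \<subseteq> Y" | (all) "{x, y, z, w} \<subseteq> Y"
      | (one) "{x, y} \<subseteq> Y" "\<not> {z, w} \<subseteq> Y" | (other) "\<not> {x, y} \<subseteq> Y" "{z, w} \<subseteq> Y" by blast
    then show ?thesis
    proof cases
      case none
      then have none': "{e \<in> {{x, y}, {z, w}}. e \<subseteq> Y} = {}" by auto
      show ?thesis using le ci[OF Y(1) YV(1)] unfolding none' by simp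
    next
      case all
      have "card {e \<in> {{x, y}, {z, w}}. e \<subseteq> Y} \<le> card {{x, y}, {z, w}}"
        by (rule card_mono) auto
      then have two: "card {e \<in> {{x, y}, {z, w}}. e \<subseteq> Y} \<le> 2"
        by (simp add: \<open>card {{x, y}, {z, w}} = 2\<close>)
      have "{e \<in> E. e \<subseteq> insert v Y} = {e \<in> E. e \<subseteq> Y} \<union> {e \<in> E. v \<in> e}"
      proof (intro equalityI subsetI)
        fix e assume "e \<in> {e \<in> E. e \<subseteq> Y} \<union> {e \<in> E. v \<in> e}"
        moreover have "e \<subseteq> insert v Y" if e: "e \<in> E" "v \<in> e"
        proof -
          obtain u where u: "e = {v, u}" using simple_graph_edgeE[OF G e] by metis
          then have "u \<in> neighbours E v" using e by (simp add: neighbours_def)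
          then show ?thesis using u N all by auto
        qed
        ultimately show "e \<in> {e \<in> E. e \<subseteq> insert v Y}" by auto
      qed auto
      then have "induced_edges E (insert v Y) = induced_edges E Y + 4"
        unfolding induced_edges_def using finE YV \<open>card {e \<in> E. v \<in> e} = 4\<close>
        by (simp, subst card_Un_disjoint) auto
      moreover have "induced_edges E (insert v Y) \<le> 2 * card (insert v Y) - 1"
        using Y v by (intro ci) auto
      ultimately show ?thesis using le two YV finY by simp
    next
      case one
      then have "{e \<in> {{x, y}, {z, w}}. e \<subseteq> Y} = {{x, y}}" by auto
      moreover have "induced_edges E Y \<le> 2 * card Y - 2"
        using one d vE by (intro induced_edges_le_of_two_neighbours[OF C reg ess YV, of x y]) auto
      ultimately show ?thesis using le pos by simp
    next
      case other
      then have "{e \<in> {{x, y}, {z, w}}. e \<subseteq> Y} = {{z, w}}" by auto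
      moreover have "induced_edges E Y \<le> 2 * card Y - 2"
        using other d vE by (intro induced_edges_le_of_two_neighbours[OF C reg ess YV, of z w]) auto
      ultimately show ?thesis using le pos by simp
    qed
  qed
  then have "circuit_2_1 (V - {v}) ?E" using simple card by (simp add: circuit_2_1_def)
  then show ?thesis
    unfolding admissible_def using v reg[OF v] d N xy zw
    by (intro conjI exI[of _ x] exI[of _ y] exI[of _ z] exI[of _ w])
qed

section \<open>Twins of non-admissible vertices\<close>

lemma no_triangle_in_neighbourhood:
  assumes C: "circuit_2_1 V E" and reg: "\<And>u. u \<in> V \<Longrightarrow> degree E u = 4"
    and ess: "essentially_edge_connected 5 V E"
    and K5: "\<not> isomorphic_graphs V E {..<5} (complete_edges 5)"
    and N: "a \<in> neighbours E v" "b \<in> neighbours E v" "c \<in> neighbours E v"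
  shows "\<not> ({a, b} \<in> E \<and> {b, c} \<in> E \<and> {a, c} \<in> E)"
proof
  assume E: "{a, b} \<in> E \<and> {b, c} \<in> E \<and> {a, c} \<in> E"
  have G: "simple_graph V E" using C by (simp add: circuit_2_1_def)
  have vE: "{v, a} \<in> E" "{v, b} \<in> E" "{v, c} \<in> E" using N by (auto simp: neighbours_def)
  have d: "distinct [v, a, b, c]"
    using E vE simple_graph_edge_ends(1)[OF G] by auto
  have "[{v, a, b, c}]\<^bsup>2\<^esup> \<subseteq> E"
  proof
    fix e assume "e \<in> [{v, a, b, c}]\<^bsup>2\<^esup>"
    then obtain p q where "e = {p, q}" "p \<noteq> q" "p \<in> {v, a, b, c}" "q \<in> {v, a, b, c}"
      by (auto simp: nsets_def card_2_iff)
    then show "e \<in> E" using E vE by (auto simp: insert_commute)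
  qed
  then show False using no_complete_four[OF C reg ess K5, of "{v, a, b, c}"] d by simp
qed

text \<open>
  Choosing one edge from each of the three perfect matchings on \<open>N(v)\<close> gives a triangle or a claw.
  Triangles are excluded, and the centre \<open>c\<close> of a claw is adjacent to \<open>v\<close> and to the rest of \<open>N(v)\<close>, which
  are already four neighbours.
\<close>
lemma not_admissible_twin:
  assumes C: "circuit_2_1 V E" and reg: "\<And>u. u \<in> V \<Longrightarrow> degree E u = 4"
    and ess: "essentially_edge_connected 5 V E"
    and K5: "\<not> isomorphic_graphs V E {..<5} (complete_edges 5)"
    and v: "v \<in> V" and na: "\<not> admissible V E v"
  obtains c where "c \<in> neighbours E v" "insert c (neighbours E c) = insert v (neighbours E v)"
proof -
  have G: "simple_graph V E" using C by (simp add: circuit_2_1_def)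
  let ?N = "neighbours E"
  have deg: "card (?N u) = 4" if "u \<in> V" for u
    using card_neighbours[OF G, of u] reg[OF that] by simp
  obtain x where x: "x \<in> ?N v"
    using deg[OF v] by fastforce
  then have "card (?N v - {x}) = 3" using deg[OF v] by simp
  then obtain y z w where yzw: "?N v - {x} = {y, z, w}" "y \<noteq> z" "y \<noteq> w" "z \<noteq> w"
    by (auto simp: card_3_iff)
  then have N: "?N v = {x, y, z, w}" and d: "distinct [x, y, z, w]"
    using x by auto
  \<comment> \<open>Each of the three ways to pair the neighbours contains an adjacent pair.\<close>
  have nx: "{x, y} \<in> E \<or> {z, w} \<in> E" "{x, z} \<in> E \<or> {y, w} \<in> E" "{x, w} \<in> E \<or> {y, z} \<in> E"
    using admissibleI[OF C reg ess v, of x y z w] admissibleI[OF C reg ess v, of x z y w]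
      admissibleI[OF C reg ess v, of x w y z] d N na by (auto simp: insert_commute)
  have notri: "\<not> ({a, b} \<in> E \<and> {b, c} \<in> E \<and> {a, c} \<in> E)"
    if "a \<in> ?N v" "b \<in> ?N v" "c \<in> ?N v" for a b c
    using no_triangle_in_neighbourhood[OF C reg ess K5 that] by blast
  have "\<exists>c\<in>?N v. \<forall>u\<in>?N v - {c}. {c, u} \<in> E"
    using nx notri[of x y z] notri[of x y w] notri[of x z w] notri[of y z w] unfolding N
    by (auto simp: insert_commute)
  then obtain c where c: "c \<in> ?N v" "\<And>u. u \<in> ?N v - {c} \<Longrightarrow> {c, u} \<in> E" by blast
  have vc: "{v, c} \<in> E" using c(1) by (simp add: neighbours_def)
  have cV: "c \<in> V" "c \<noteq> v" using simple_graph_edge_ends[OF G vc] by auto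
  have vN: "v \<notin> ?N v" using simple_graph_edge_ends(1)[OF G, of v v] by (auto simp: neighbours_def)
  have fin: "finite (?N u)" if "u \<in> V" for u
    using deg[OF that] by (metis card.infinite zero_neq_numeral)
  have "insert v (?N v - {c}) \<subseteq> ?N c"
    using c vc by (auto simp: neighbours_def insert_commute)
  moreover have "card (insert v (?N v - {c})) = card (?N c)"
    using deg[OF v] deg[OF cV(1)] c(1) vN fin[OF v] by simp
  ultimately have "?N c = insert v (?N v - {c})"
    using fin[OF cV(1)] by (metis card_subset_eq)
  then have "insert c (?N c) = insert v (?N v)" using c(1) by auto
  with c(1) show ?thesis by (rule that)
qed

theorem theorem1p2:
  fixes V :: "'a set" and E :: "'a set set"
  assumes "circuit_2_1 V E"
    and "essentially_edge_connected 5 V E"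
    and "\<not> isomorphic_graphs V E {..<5} (complete_edges 5)"
    and "min_degree V E = 4"
  shows "\<exists>v\<in>V. admissible V E v"
proof (rule ccontr)
  assume na: "\<not> (\<exists>v\<in>V. admissible V E v)"
  note C = assms(1) and ess = assms(2) and K5 = assms(3)
  have reg: "\<And>u. u \<in> V \<Longrightarrow> degree E u = 4"
    using circuit_min_degree_4_regular[OF C assms(4)] .
  have G: "simple_graph V E" using C by (simp add: circuit_2_1_def)
  let ?N = "neighbours E"
  have sym: "a \<in> ?N b \<longleftrightarrow> b \<in> ?N a" for a b
    by (simp add: neighbours_def insert_commute)
  have irr: "a \<notin> ?N a" for a
    using simple_graph_edge_ends(1)[OF G, of a a] by (auto simp: neighbours_def)
  obtain v where v: "v \<in> V" using G by (auto simp: simple_graph_def)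
  obtain c where c: "c \<in> ?N v" "insert c (?N c) = insert v (?N v)"
    using not_admissible_twin[OF C reg ess K5 v] na v by metis
  \<comment> \<open>Neighbours of \<open>v\<close> other than \<open>c\<close> are also neighbours of \<open>c\<close>, so two adjacent ones would form
    a triangle with \<open>v\<close> inside \<open>N(c)\<close>.\<close>
  have ind: "b \<notin> ?N a" if "a \<in> ?N v - {c}" "b \<in> ?N v - {c}" for a b
  proof -
    have "a \<in> ?N c" "b \<in> ?N c" using that c(2) irr by blast+
    then show ?thesis
      using no_triangle_in_neighbourhood[OF C reg ess K5, of c v a b] c(1) that
      by (auto simp: neighbours_def)
  qed
  have card: "card (?N v) = 4" using card_neighbours[OF G, of v] reg[OF v] by simp
  then have "card (?N v - {c}) = 3" using c(1) by simp
  then obtain y z where yz: "y \<in> ?N v - {c}" "z \<in> ?N v - {c}" "y \<noteq> z"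
    by (auto simp: card_3_iff)
  have yV: "y \<in> V" using yz simple_graph_edge_ends[OF G, of v y] by (simp add: neighbours_def)
  obtain d where d: "d \<in> ?N y" "insert d (?N d) = insert y (?N y)"
    using not_admissible_twin[OF C reg ess K5 yV] na yV by metis
  have "v \<in> ?N y" using yz sym by blast
  then have "v \<in> insert d (?N d)" using d by blast
  then have "d \<in> insert v (?N v)" using sym by blast
  \<comment> \<open>If \<open>d\<close> is \<open>v\<close> or \<open>c\<close>, its closed neighbourhood contains \<open>z\<close>; otherwise \<open>d\<close> itself is a neighbour
    of \<open>y\<close> in \<open>N(v) - {c}\<close>.  Either way \<open>y\<close> has a neighbour in that independent set.\<close>
  then consider "d = v" | "d = c" | "d \<in> ?N v - {c}" by blast
  then show False
  proof cases
    case 1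
    then have "z \<in> insert y (?N y)" unfolding d(2)[symmetric] using yz by simp
    then show False using ind yz by blast
  next
    case 2
    then have "z \<in> insert y (?N y)" unfolding d(2)[symmetric] using c(2) yz by simp
    then show False using ind yz by blast
  next
    case 3
    then show False using ind yz d by blast
  qed
qed

end
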